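(* Let $p\ge2$ and let $m_1,\dots,m_p$ be positive integers. For every point $(x_1,\dots,x_p)\in\mathcal{S}^p$, the step length $k(x_1,\dots,x_p)$ equals $2\,\mathrm{lcm}(m_1,\dots,m_p)$; in particular it does not depend on the point.
   Context: $\mathcal{S}^p=\{(x_1,\dots,x_p)\in\mathbb{Z}^p: 0\le x_i\le m_i\}$. For a positive integer $m$ let $\varphi_m(u)=\min_{n\in\mathbb{Z}}|u-2nm|$ for $u\in\mathbb{Z}$. For $k\in\mathbb{Z}$ put $F^k(x_1,\dots,x_p)=(\varphi_{m_1}(x_1+k),\dots,\varphi_{m_p}(x_p+k))$ (the position after $k$ steps of a light beam started in direction $(+1,\dots,+1)$ reflecting in the boundary of $\prod_i[0,m_i]$); in particular $F^{-1}(x_1,\dots,x_p)=(\varphi_{m_1}(x_1-1),\dots,\varphi_{m_p}(x_p-1))$. The step length $k(x_1,\dots,x_p)$ is the smallest positive integer $k$ with $F^k(x_1,\dots,x_p)=(x_1,\dots,x_p)$ and $F^{k-1}(x_1,\dots,x_p)=F^{-1}(x_1,\dots,x_p)$. *)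

theory Defs
  imports Main "HOL-Library.FuncSet"
begin

text \<open>A point \<open>(x\<^sub>1, \<dots>, x\<^sub>p)\<close> is a function in \<open>extensional {1..p}\<close>
  (undefined outside \<open>{1..p}\<close>), so that equality of functions is equality of \<open>p\<close>-tuples.\<close>

definition lattice_box :: "nat \<Rightarrow> (nat \<Rightarrow> nat) \<Rightarrow> (nat \<Rightarrow> int) set" where
  "lattice_box p m = (\<Pi>\<^sub>E i\<in>{1..p}. {0..int (m i)})"

definition fold_coord :: "nat \<Rightarrow> int \<Rightarrow> int" where
  "fold_coord m u = (LEAST v. \<exists>n::int. v = \<bar>u - 2 * n * int m\<bar>)"

definition beam_pos :: "nat \<Rightarrow> (nat \<Rightarrow> nat) \<Rightarrow> int \<Rightarrow> (nat \<Rightarrow> int) \<Rightarrow> (nat \<Rightarrow> int)" where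
  "beam_pos p m k x = (\<lambda>i\<in>{1..p}. fold_coord (m i) (x i + k))"

definition returns_after :: "nat \<Rightarrow> (nat \<Rightarrow> nat) \<Rightarrow> (nat \<Rightarrow> int) \<Rightarrow> nat \<Rightarrow> bool" where
  "returns_after p m x k \<longleftrightarrow>
     k > 0 \<and> beam_pos p m (int k) x = x \<and> beam_pos p m (int k - 1) x = beam_pos p m (-1) x"

definition step_length :: "nat \<Rightarrow> (nat \<Rightarrow> nat) \<Rightarrow> (nat \<Rightarrow> int) \<Rightarrow> nat" where
  "step_length p m x = (LEAST k. returns_after p m x k)"

text \<open>The two uses of \<open>LEAST\<close> are well-defined: the type \<^typ>\<open>int\<close> is not well-ordered, so the
  first lemma checks that the minimum in \<^const>\<open>fold_coord\<close> is attained; the last one checks that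
  the set minimised in \<^const>\<open>step_length\<close> is nonempty.\<close>

lemma fold_coord_is_min:
  shows "\<exists>n. fold_coord m u = \<bar>u - 2 * n * int m\<bar>"
    and "fold_coord m u \<le> \<bar>u - 2 * n * int m\<bar>"
proof -
  define g where "g = (\<lambda>n::int. nat \<bar>u - 2 * n * int m\<bar>)"
  obtain n0 where n0: "\<And>n. g n0 \<le> g n"
    using ex_has_least_nat[of "\<lambda>_. True" 0 g] by auto
  have le: "\<bar>u - 2 * n0 * int m\<bar> \<le> \<bar>u - 2 * n * int m\<bar>" for n
    using n0[of n] unfolding g_def by linarith
  have eq: "fold_coord m u = \<bar>u - 2 * n0 * int m\<bar>"
    unfolding fold_coord_def by (rule Least_equality) (use le in auto)
  show "\<exists>n. fold_coord m u = \<bar>u - 2 * n * int m\<bar>" using eq by blast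
  show "fold_coord m u \<le> \<bar>u - 2 * n * int m\<bar>" using eq le by simp
qed

lemma fold_coord_shift: "fold_coord m (u + 2 * j * int m) = fold_coord m u"
proof (rule antisym)
  obtain n where n: "fold_coord m u = \<bar>u - 2 * n * int m\<bar>"
    using fold_coord_is_min(1) by blast
  show "fold_coord m (u + 2 * j * int m) \<le> fold_coord m u"
    using fold_coord_is_min(2)[of m "u + 2 * j * int m" "n + j"] n by (simp add: algebra_simps)
next
  obtain n where n: "fold_coord m (u + 2 * j * int m) = \<bar>u + 2 * j * int m - 2 * n * int m\<bar>"
    using fold_coord_is_min(1) by blast
  show "fold_coord m u \<le> fold_coord m (u + 2 * j * int m)"
    using fold_coord_is_min(2)[of m u "n - j"] n by (simp add: algebra_simps)
qed

lemma fold_coord_id: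
  assumes "0 \<le> u" "u \<le> int m"
  shows "fold_coord m u = u"
proof (rule antisym)
  show "fold_coord m u \<le> u" using fold_coord_is_min(2)[of m u 0] assms by simp
  obtain n where n: "fold_coord m u = \<bar>u - 2 * n * int m\<bar>"
    using fold_coord_is_min(1) by blast
  show "u \<le> fold_coord m u"
  proof (cases "n \<le> 0")
    case True
    then have "n * int m \<le> 0" by (simp add: mult_nonpos_nonneg)
    then show ?thesis using n by linarith
  next
    case False
    then have "1 * int m \<le> n * int m" by (intro mult_right_mono) auto
    then show ?thesis using n assms by linarith
  qed
qed

lemma returns_after_exists:
  assumes "\<forall>i\<in>{1..p}. m i > 0" "x \<in> lattice_box p m"
  shows "\<exists>k. returns_after p m x k"
proof -
  define k where "k = 2 * (\<Prod>i\<in>{1..p}. m i)"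
  have per: "fold_coord (m i) (u + int k) = fold_coord (m i) u" if "i \<in> {1..p}" for i u
  proof -
    have "m i dvd (\<Prod>i\<in>{1..p}. m i)" using that by (intro dvd_prodI) auto
    then obtain c where "(\<Prod>i\<in>{1..p}. m i) = m i * c" by (rule dvdE)
    then have "int k = 2 * int c * int (m i)" by (simp add: k_def)
    then show ?thesis by (simp add: fold_coord_shift)
  qed
  have "k > 0" using assms(1) by (simp add: k_def prod_pos)
  moreover have "beam_pos p m (int k) x = x"
  proof
    fix i
    show "beam_pos p m (int k) x i = x i"
      using assms(2) per[of i "x i"] fold_coord_id[of "x i" "m i"]
      by (cases "i \<in> {1..p}") (auto simp: beam_pos_def lattice_box_def PiE_def extensional_def Pi_def)
  qed
  moreover have "beam_pos p m (int k - 1) x = beam_pos p m (-1) x"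
  proof
    fix i
    show "beam_pos p m (int k - 1) x i = beam_pos p m (-1) x i"
      using per[of i "x i - 1"] by (auto simp: beam_pos_def algebra_simps)
  qed
  ultimately show ?thesis unfolding returns_after_def by blast
qed

end

theory Submission imports Defs begin

text \<open>Since \<open>fold_coord m u\<close> represents the class of \<open>\<plusminus>u\<close> modulo \<open>2 * m\<close>, a return in coordinate
  \<open>i\<close> forces either \<open>k \<equiv> 0\<close>, or \<open>k \<equiv> -2x\<close> and \<open>k \<equiv> 2 - 2x\<close> modulo \<open>2 * m\<close>. The second case gives
  \<open>m = 1\<close> and \<open>k\<close> even, so again \<open>k \<equiv> 0\<close>. Hence the return times are the common multiples of the
  numbers \<open>2 * m i\<close>.\<close>

lemma fold_coord_eqD:
  assumes "fold_coord m u = fold_coord m v"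
  shows "2 * int m dvd u - v \<or> 2 * int m dvd u + v"
proof -
  obtain a b where "\<bar>u - 2 * a * int m\<bar> = \<bar>v - 2 * b * int m\<bar>"
    using assms fold_coord_is_min(1) by metis
  then consider "u - v = 2 * int m * (a - b)" | "u + v = 2 * int m * (a + b)"
    by (auto simp: abs_eq_iff algebra_simps)
  then show ?thesis by (metis dvd_triv_left)
qed

lemma fold_coord_add_multiple:
  assumes "2 * int m dvd k"
  shows "fold_coord m (u + k) = fold_coord m u"
  using assms fold_coord_shift by (metis dvd_def mult.assoc mult.commute)

lemma fold_coord_return_iff:
  "fold_coord m (u + k) = fold_coord m u \<and> fold_coord m (u + k - 1) = fold_coord m (u - 1)
     \<longleftrightarrow> 2 * int m dvd k"
proof
  assume h: "fold_coord m (u + k) = fold_coord m u \<and> fold_coord m (u + k - 1) = fold_coord m (u - 1)"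
  show "2 * int m dvd k"
  proof (rule ccontr)
    assume nd: "\<not> 2 * int m dvd k"
    \<comment> \<open>As \<open>k\<close> is no multiple of \<open>2 * int m\<close>,
      \<open>fold_coord_eqD\<close> leaves only the reflected alternative, here and for the
      preceding position.\<close>
    have 1: "2 * int m dvd 2 * u + k"
      using fold_coord_eqD[of m "u + k" u] h nd by (simp add: algebra_simps)
    have 2: "2 * int m dvd 2 * u + k - 2"
      using fold_coord_eqD[of m "u + k - 1" "u - 1"] h nd by (simp add: algebra_simps)
    \<comment> \<open>The two sums differ by 2; writing it as \<open>2 * 1\<close> lets the factor 2
      cancel, leaving \<open>int m dvd 1\<close>.\<close>
    have "2 * int m dvd 2 * 1"
      using dvd_diff[OF 1 2] by simp
    then have "m = 1"
      by (simp only: dvd_mult_cancel_left) simp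
    then show False using 1 nd by simp
  qed
next
  assume "2 * int m dvd k"
  then show "fold_coord m (u + k) = fold_coord m u \<and> fold_coord m (u + k - 1) = fold_coord m (u - 1)"
    using fold_coord_add_multiple[of m k u] fold_coord_add_multiple[of m k "u - 1"]
    by (simp add: algebra_simps)
qed

lemma returns_after_iff:
  assumes "x \<in> lattice_box p m"
  shows "returns_after p m x k \<longleftrightarrow> k > 0 \<and> (\<forall>i\<in>{1..p}. 2 * m i dvd k)"
proof -
  have fold_x: "fold_coord (m i) (x i) = x i" if "i \<in> {1..p}" for i
    using assms that by (auto simp: lattice_box_def PiE_iff intro: fold_coord_id)
  \<comment> \<open>\<open>beam_pos\<close> takes the same default value off \<open>{1..p}\<close>,
    so equality of functions reduces to the coordinates.\<close>
  have "x i = undefined" if "i \<notin> {1..p}" for i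
    using assms that by (auto simp: lattice_box_def)
  then have pos: "beam_pos p m (int k) x = x \<longleftrightarrow>
      (\<forall>i\<in>{1..p}. fold_coord (m i) (x i + int k) = fold_coord (m i) (x i))"
    using fold_x by (auto simp: beam_pos_def restrict_def fun_eq_iff)
  have prev: "beam_pos p m (int k - 1) x = beam_pos p m (-1) x \<longleftrightarrow>
      (\<forall>i\<in>{1..p}. fold_coord (m i) (x i + int k - 1) = fold_coord (m i) (x i - 1))"
    by (auto simp: beam_pos_def restrict_def fun_eq_iff algebra_simps)
  have "2 * int (m i) dvd int k \<longleftrightarrow> 2 * m i dvd k" for i
    by (metis int_dvd_int_iff of_nat_mult of_nat_numeral)
  then show ?thesis
    unfolding returns_after_def pos prev using fold_coord_return_iff by blast
qed

text \<open>Halving \<open>k\<close> reduces this to the universal property of the LCM. For empty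
  \<open>I\<close> the left side is vacuous, while the right side still asks for even
  \<open>k\<close>.\<close>

lemma common_multiple_double_iff:
  fixes m :: "'a \<Rightarrow> nat"
  assumes "I \<noteq> {}"
  shows "(\<forall>i\<in>I. 2 * m i dvd k) \<longleftrightarrow> 2 * (LCM i\<in>I. m i) dvd k"
proof
  assume h: "\<forall>i\<in>I. 2 * m i dvd k"
  with assms have "2 dvd k" by (meson dvd_mult_left ex_in_conv)
  then obtain j where "k = 2 * j" ..
  with h show "2 * (LCM i\<in>I. m i) dvd k" by (auto intro: Lcm_least)
next
  assume h: "2 * (LCM i\<in>I. m i) dvd k"
  show "\<forall>i\<in>I. 2 * m i dvd k"
    by (intro ballI dvd_trans[OF _ h] mult_dvd_mono dvd_Lcm) auto
qed

lemma step_length_eq: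
  assumes "p \<ge> 1" "\<forall>i\<in>{1..p}. m i > 0" "x \<in> lattice_box p m"
  shows "step_length p m x = 2 * (LCM i\<in>{1..p}. m i)"
proof -
  have iff: "returns_after p m x k \<longleftrightarrow> k > 0 \<and> 2 * (LCM i\<in>{1..p}. m i) dvd k" for k
    using returns_after_iff[OF assms(3)] common_multiple_double_iff[of "{1..p}" m k] assms(1)
    by simp
  \<comment> \<open>Positivity makes twice the LCM itself a return time; every other one is a
    positive multiple of it, hence no smaller.\<close>
  have "(LCM i\<in>{1..p}. m i) > 0"
    using assms(2) by (intro gr0I) (auto simp: Lcm_0_iff)
  then show ?thesis
    unfolding step_length_def by (intro Least_equality) (auto simp: iff intro: dvd_imp_le)
qed

theorem theorem4p8:
  fixes p :: nat and m :: "nat \<Rightarrow> nat"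
  assumes "p \<ge> 2"
    and "\<forall>i\<in>{1..p}. m i > 0"
  shows "(\<forall>x\<in>lattice_box p m. step_length p m x = 2 * (LCM i\<in>{1..p}. m i)) \<and>
         (\<forall>x\<in>lattice_box p m. \<forall>y\<in>lattice_box p m. step_length p m x = step_length p m y)"
  using assms by (simp add: step_length_eq)

end
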